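(* Let $X$ be a set with $n$ elements and $k$ a field of characteristic $0$ or of characteristic $p>n$. Let $m_1,\dots,m_s$ be positive integers, $V=U^{\otimes m_1}\oplus\cdots\oplus U^{\otimes m_s}\oplus k$, and $d\ge1$ with $\ell(V)\le 2d$. Then every formula $\varphi(x_1,\dots,x_d)$ of $\mathsf C_d$ is represented by a $2d$-constructible equivariant $f:V\to U^{\otimes d}$, i.e. for every structure $\Gamma=\langle X,Y_1,\dots,Y_s\rangle$ with $Y_i\subseteq X^{m_i}$, $$f(A_\Gamma)=\sum_{(a_1,\dots,a_d)\in X^d,\ \Gamma\models\varphi(a_1,\dots,a_d)}a_1\otimes\cdots\otimes a_d.$$
   Context: $G=\Sigma(X)$ viewed as a finite constant algebraic group over $k$: $R=k[G]$ = functions $G\to k$, $\Delta f(g,h)=f(gh)$, $\sigma_e f=f(e)$, $\iota f(g)=f(g^{-1})$. $U=k^X$ with basis $X$ permuted by $G$; $W\subseteq R$ is the span of the constant $1$ and the matrix coefficients $g\mapsto g_{x,y}$; $R_0=k$, $R_d=W^d$. Representations: $U^{\otimes m}$ (diagonal action), trivial $k$, direct sums, each given by coassociative counital $\mu:V\to V\otimes R$; $\ell(V)$ = least $\ell$ with $\mu(V)\subseteq V\otimes R_\ell$; linear $f$ is equivariant if $\mu'\circ f=(f\otimes\mathrm{id})\circ\mu$. For $Y\subseteq X^m$, $\mathrm{tensor}(Y)=\sum_{(x_1,\dots,x_m)\in Y}x_1\otimes\cdots\otimes x_m$; $A_\Gamma=(\mathrm{tensor}(Y_1),\dots,\mathrm{tensor}(Y_s),1)\in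 V$. $\mathsf C_d$: first-order formulas in the language with equality and relation symbols $Y_i$ of arity $m_i$, using only the variables $x_1,\dots,x_d$ (reuse allowed), together with counting quantifiers $\exists_b x\,\psi$ (true iff exactly $b$ elements satisfy $\psi$). $e$-constructible equivariants: smallest class of maps between representations containing every equivariant linear $f:V\to V'$ with $\ell(V),\ell(V')\le e$, every $V_1\oplus V_2\to V_1\otimes V_2$, $(v_1,v_2)\mapsto v_1\otimes v_2$ with $\ell(V_1)+\ell(V_2)\le e$, closed under linear combinations and composition. *)

theory Defs
  imports
    Complex_Main
    "HOL-Library.Function_Algebras"
    "HOL-Combinatorics.Permutations"
begin

section \<open>Coordinate spaces\<close>

definition fscale :: "'k::field \<Rightarrow> ('b \<Rightarrow> 'k) \<Rightarrow> ('b \<Rightarrow> 'k)" where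
  "fscale c v = (\<lambda>b. c * v b)"

interpretation fvs: vector_space "fscale :: 'k::field \<Rightarrow> ('b \<Rightarrow> 'k) \<Rightarrow> ('b \<Rightarrow> 'k)"
  by unfold_locales (auto simp: fscale_def algebra_simps)

text \<open>The vector space \<open>k^B\<close> with basis the (finite) set \<open>B\<close>.\<close>

definition fspace :: "'b set \<Rightarrow> ('b \<Rightarrow> 'k::field) set" where
  "fspace B = {v. \<forall>b. b \<notin> B \<longrightarrow> v b = 0}"

definition unit_vec :: "'b \<Rightarrow> ('b \<Rightarrow> 'k::field)" where
  "unit_vec b = (\<lambda>c. if c = b then 1 else 0)"

definition linear_between :: "('b \<Rightarrow> 'k::field) set \<Rightarrow> ('c \<Rightarrow> 'k) set \<Rightarrow> (('b \<Rightarrow> 'k) \<Rightarrow> ('c \<Rightarrow> 'k)) \<Rightarrow> bool" where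
  "linear_between V V' f \<longleftrightarrow>
     (\<forall>v\<in>V. f v \<in> V') \<and>
     (\<forall>u\<in>V. \<forall>v\<in>V. f (u + v) = f u + f v) \<and>
     (\<forall>c. \<forall>v\<in>V. f (fscale c v) = fscale c (f v))"

text \<open>
  The tensor product of \<open>k^B\<close> and \<open>k^C\<close> (\<open>B\<close>, \<open>C\<close> finite) is \<open>k^(B \<times> C)\<close>. For \<open>f\<close> linear,
  \<open>map_left f\<close> and \<open>map_right f\<close> are \<open>f \<otimes> id\<close> and \<open>id \<otimes> f\<close>: they send \<open>pure_tensor v r\<close>
  to \<open>pure_tensor (f v) r\<close> and to \<open>pure_tensor v (f r)\<close>.
\<close>

definition pure_tensor :: "('b \<Rightarrow> 'k::field) \<Rightarrow> ('c \<Rightarrow> 'k) \<Rightarrow> ('b \<times> 'c \<Rightarrow> 'k)" where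
  "pure_tensor v r = (\<lambda>(b, c). v b * r c)"

definition subspace_tensor :: "('b \<Rightarrow> 'k::field) set \<Rightarrow> ('c \<Rightarrow> 'k) set \<Rightarrow> ('b \<times> 'c \<Rightarrow> 'k) set" where
  "subspace_tensor V S = fvs.span {pure_tensor v r | v r. v \<in> V \<and> r \<in> S}"

definition map_left :: "(('b \<Rightarrow> 'k::field) \<Rightarrow> ('b' \<Rightarrow> 'k)) \<Rightarrow> ('b \<times> 'c \<Rightarrow> 'k) \<Rightarrow> ('b' \<times> 'c \<Rightarrow> 'k)" where
  "map_left f t = (\<lambda>(b, c). f (\<lambda>a. t (a, c)) b)"

definition map_right :: "(('c \<Rightarrow> 'k::field) \<Rightarrow> ('c' \<Rightarrow> 'k)) \<Rightarrow> ('b \<times> 'c \<Rightarrow> 'k) \<Rightarrow> ('b \<times> 'c' \<Rightarrow> 'k)" where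
  "map_right f t = (\<lambda>(b, c). f (\<lambda>a. t (b, a)) c)"


section \<open>The coordinate ring of the symmetric group\<close>

definition sym_group :: "'x set \<Rightarrow> ('x \<Rightarrow> 'x) set" where
  "sym_group X = {g. g permutes X}"

abbreviation coord_ring :: "'x set \<Rightarrow> (('x \<Rightarrow> 'x) \<Rightarrow> 'k::field) set" where
  "coord_ring X \<equiv> fspace (sym_group X)"

definition ring_one :: "'x set \<Rightarrow> ('x \<Rightarrow> 'x) \<Rightarrow> 'k::field" where
  "ring_one X = (\<lambda>g. if g \<in> sym_group X then 1 else 0)"

definition comult :: "'x set \<Rightarrow> (('x \<Rightarrow> 'x) \<Rightarrow> 'k::field) \<Rightarrow> (('x \<Rightarrow> 'x) \<times> ('x \<Rightarrow> 'x) \<Rightarrow> 'k)" where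
  "comult X r = (\<lambda>(g, h). if g \<in> sym_group X \<and> h \<in> sym_group X then r (g \<circ> h) else 0)"

definition counit :: "(('x \<Rightarrow> 'x) \<Rightarrow> 'k::field) \<Rightarrow> 'k" where
  "counit r = r id"

text \<open>The entries of the matrix of \<open>g\<close> acting on \<open>k^X\<close>: \<open>g y = \<Sum>x\<in>X. mat_coeff X x y g \<cdot> x\<close>.\<close>

definition mat_coeff :: "'x set \<Rightarrow> 'x \<Rightarrow> 'x \<Rightarrow> ('x \<Rightarrow> 'x) \<Rightarrow> 'k::field" where
  "mat_coeff X x y = (\<lambda>g. if g \<in> sym_group X \<and> g y = x then 1 else 0)"

definition gen_space :: "'x set \<Rightarrow> (('x \<Rightarrow> 'x) \<Rightarrow> 'k::field) set" where
  "gen_space X = fvs.span (insert (ring_one X) {mat_coeff X x y | x y. x \<in> X \<and> y \<in> X})"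

primrec filtration :: "'x set \<Rightarrow> nat \<Rightarrow> (('x \<Rightarrow> 'x) \<Rightarrow> 'k::field) set" where
  "filtration X 0 = fvs.span {ring_one X}"
| "filtration X (Suc l) = fvs.span {w * r | w r. w \<in> gen_space X \<and> r \<in> filtration X l}"


section \<open>Representations\<close>

text \<open>
  Labels for basis vectors, closed under what direct sums and tensor products need. There are
  infinitely many labels, so every finite-dimensional representation is isomorphic to one whose
  basis is a finite set of labels.
\<close>

datatype 'x label =
    Pt
  | Word "'x list"
  | InL "'x label"
  | InR "'x label"
  | Pr "'x label" "'x label"

type_synonym ('x, 'k) vec = "'x label \<Rightarrow> 'k"

record ('x, 'k) rep =
  basis :: "'x label set"
  coact :: "('x, 'k) vec \<Rightarrow> ('x label \<times> ('x \<Rightarrow> 'x) \<Rightarrow> 'k)"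

abbreviation carr :: "('x, 'k::field) rep \<Rightarrow> ('x, 'k) vec set" where
  "carr V \<equiv> fspace (basis V)"

definition is_rep :: "'x set \<Rightarrow> ('x, 'k::field) rep \<Rightarrow> bool" where
  "is_rep X V \<longleftrightarrow>
     finite (basis V) \<and>
     linear_between (carr V) (subspace_tensor (carr V) (coord_ring X)) (coact V) \<and>
     (\<forall>v\<in>carr V. \<forall>b g h.
        map_left (coact V) (coact V v) ((b, g), h) = map_right (comult X) (coact V v) (b, (g, h))) \<and>
     (\<forall>v\<in>carr V. \<forall>b. counit (\<lambda>g. coact V v (b, g)) = v b)"

definition ell :: "'x set \<Rightarrow> ('x, 'k::field) rep \<Rightarrow> nat" where
  "ell X V = (LEAST l. coact V ` carr V \<subseteq> subspace_tensor (carr V) (filtration X l))"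

definition equivariant_linear :: "('x, 'k::field) rep \<Rightarrow> ('x, 'k) rep \<Rightarrow> (('x, 'k) vec \<Rightarrow> ('x, 'k) vec) \<Rightarrow> bool" where
  "equivariant_linear V V' f \<longleftrightarrow>
     linear_between (carr V) (carr V') f \<and>
     (\<forall>v\<in>carr V. coact V' (f v) = map_left f (coact V v))"

definition trivial_rep :: "'x set \<Rightarrow> ('x, 'k::field) rep" where
  "trivial_rep X = \<lparr>basis = {Pt}, coact = (\<lambda>v. pure_tensor v (ring_one X))\<rparr>"

text \<open>
  The word \<open>[x\<^sub>1, \<dots>, x\<^sub>m]\<close> labels the basis vector \<open>x\<^sub>1 \<otimes> \<cdots> \<otimes> x\<^sub>m\<close>. In general the coaction
  belonging to an action is \<open>coact V v (b, g) = (g v) b\<close>.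
\<close>

definition words :: "'x set \<Rightarrow> nat \<Rightarrow> 'x list set" where
  "words X m = {w. set w \<subseteq> X \<and> length w = m}"

definition tensor_power :: "'x set \<Rightarrow> nat \<Rightarrow> ('x, 'k::field) rep" where
  "tensor_power X m =
     \<lparr>basis = Word ` words X m,
      coact = (\<lambda>v (b, g). if g \<in> sym_group X
        then (\<Sum>w\<in>words X m. v (Word w) * unit_vec (Word (map g w)) b) else 0)\<rparr>"

fun sum_vec :: "('x, 'k::field) vec \<Rightarrow> ('x, 'k) vec \<Rightarrow> ('x, 'k) vec" where
  "sum_vec v w (InL b) = v b"
| "sum_vec v w (InR b) = w b"
| "sum_vec v w _ = 0"

definition proj_l :: "('x, 'k::field) vec \<Rightarrow> ('x, 'k) vec" where
  "proj_l v = (\<lambda>b. v (InL b))"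

definition proj_r :: "('x, 'k::field) vec \<Rightarrow> ('x, 'k) vec" where
  "proj_r v = (\<lambda>b. v (InR b))"

definition sum_rep :: "('x, 'k::field) rep \<Rightarrow> ('x, 'k) rep \<Rightarrow> ('x, 'k) rep" where
  "sum_rep V V' =
     \<lparr>basis = InL ` basis V \<union> InR ` basis V',
      coact = (\<lambda>v (b, g). sum_vec (\<lambda>c. coact V (proj_l v) (c, g))
                                   (\<lambda>c. coact V' (proj_r v) (c, g)) b)\<rparr>"

fun tensor_vec :: "('x, 'k::field) vec \<Rightarrow> ('x, 'k) vec \<Rightarrow> ('x, 'k) vec" where
  "tensor_vec v w (Pr b c) = v b * w c"
| "tensor_vec v w _ = 0"

definition tensor_rep :: "('x, 'k::field) rep \<Rightarrow> ('x, 'k) rep \<Rightarrow> ('x, 'k) rep" where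
  "tensor_rep V V' =
     \<lparr>basis = {Pr b c | b c. b \<in> basis V \<and> c \<in> basis V'},
      coact = (\<lambda>t (a, g). \<Sum>b\<in>basis V. \<Sum>c\<in>basis V'. t (Pr b c) *
        tensor_vec (\<lambda>b'. coact V (unit_vec b) (b', g)) (\<lambda>c'. coact V' (unit_vec c) (c', g)) a)\<rparr>"


section \<open>Constructible equivariants\<close>

inductive constructible ::
  "'x set \<Rightarrow> nat \<Rightarrow> ('x, 'k::field) rep \<Rightarrow> ('x, 'k) rep \<Rightarrow> (('x, 'k) vec \<Rightarrow> ('x, 'k) vec) \<Rightarrow> bool"
  for X :: "'x set" and e :: nat
where
  linear: "\<lbrakk>is_rep X V; is_rep X V'; ell X V \<le> e; ell X V' \<le> e; equivariant_linear V V' f\<rbrakk>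
    \<Longrightarrow> constructible X e V V' f"
| tensor: "\<lbrakk>is_rep X V\<^sub>1; is_rep X V\<^sub>2; ell X V\<^sub>1 + ell X V\<^sub>2 \<le> e\<rbrakk>
    \<Longrightarrow> constructible X e (sum_rep V\<^sub>1 V\<^sub>2) (tensor_rep V\<^sub>1 V\<^sub>2) (\<lambda>v. tensor_vec (proj_l v) (proj_r v))"
| lincomb: "\<lbrakk>constructible X e V V' f; constructible X e V V' f'\<rbrakk>
    \<Longrightarrow> constructible X e V V' (\<lambda>v. fscale a (f v) + fscale a' (f' v))"
| comp: "\<lbrakk>constructible X e V V' f; constructible X e V' V'' f'\<rbrakk>
    \<Longrightarrow> constructible X e V V'' (f' \<circ> f)"


section \<open>Relational structures and counting logic\<close>

text \<open>
  A structure on \<open>X\<close> with relation arities \<open>ms\<close> is given by the list \<open>Ys\<close> of its relations; a tuple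
  in \<open>X^m\<close> is a word of length \<open>m\<close>.
\<close>

definition is_structure :: "'x set \<Rightarrow> nat list \<Rightarrow> 'x list set list \<Rightarrow> bool" where
  "is_structure X ms Ys \<longleftrightarrow> list_all2 (\<lambda>m Y. Y \<subseteq> words X m) ms Ys"

primrec structure_rep :: "'x set \<Rightarrow> nat list \<Rightarrow> ('x, 'k::field) rep" where
  "structure_rep X [] = trivial_rep X"
| "structure_rep X (m # ms) = sum_rep (tensor_power X m) (structure_rep X ms)"

definition tensor :: "'x list set \<Rightarrow> ('x, 'k::field) vec" where
  "tensor Y = (\<Sum>w\<in>Y. unit_vec (Word w))"

primrec structure_vec :: "'x list set list \<Rightarrow> ('x, 'k::field) vec" where
  "structure_vec [] = unit_vec Pt"
| "structure_vec (Y # Ys) = sum_vec (tensor Y) (structure_vec Ys)"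

text \<open>
  Variables and relation symbols are numbered from \<open>0\<close>; \<open>ExactlyN b j \<phi>\<close> is the counting
  quantifier \<open>\<exists>\<^sub>b x\<^sub>j \<phi>\<close>.
\<close>

datatype fm =
    Eq nat nat
  | Rel nat "nat list"
  | Neg fm
  | And fm fm
  | Or fm fm
  | Imp fm fm
  | Iff fm fm
  | Forall nat fm
  | Exists nat fm
  | ExactlyN nat nat fm

primrec in_C :: "nat \<Rightarrow> nat list \<Rightarrow> fm \<Rightarrow> bool" where
  "in_C d ms (Eq i j) \<longleftrightarrow> i < d \<and> j < d"
| "in_C d ms (Rel i js) \<longleftrightarrow> i < length ms \<and> length js = ms ! i \<and> (\<forall>j\<in>set js. j < d)"
| "in_C d ms (Neg \<phi>) \<longleftrightarrow> in_C d ms \<phi>"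
| "in_C d ms (And \<phi> \<psi>) \<longleftrightarrow> in_C d ms \<phi> \<and> in_C d ms \<psi>"
| "in_C d ms (Or \<phi> \<psi>) \<longleftrightarrow> in_C d ms \<phi> \<and> in_C d ms \<psi>"
| "in_C d ms (Imp \<phi> \<psi>) \<longleftrightarrow> in_C d ms \<phi> \<and> in_C d ms \<psi>"
| "in_C d ms (Iff \<phi> \<psi>) \<longleftrightarrow> in_C d ms \<phi> \<and> in_C d ms \<psi>"
| "in_C d ms (Forall j \<phi>) \<longleftrightarrow> j < d \<and> in_C d ms \<phi>"
| "in_C d ms (Exists j \<phi>) \<longleftrightarrow> j < d \<and> in_C d ms \<phi>"
| "in_C d ms (ExactlyN b j \<phi>) \<longleftrightarrow> j < d \<and> in_C d ms \<phi>"

primrec sat :: "'x set \<Rightarrow> 'x list set list \<Rightarrow> fm \<Rightarrow> 'x list \<Rightarrow> bool" where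
  "sat X Ys (Eq i j) a \<longleftrightarrow> a ! i = a ! j"
| "sat X Ys (Rel i js) a \<longleftrightarrow> map (\<lambda>j. a ! j) js \<in> Ys ! i"
| "sat X Ys (Neg \<phi>) a \<longleftrightarrow> \<not> sat X Ys \<phi> a"
| "sat X Ys (And \<phi> \<psi>) a \<longleftrightarrow> sat X Ys \<phi> a \<and> sat X Ys \<psi> a"
| "sat X Ys (Or \<phi> \<psi>) a \<longleftrightarrow> sat X Ys \<phi> a \<or> sat X Ys \<psi> a"
| "sat X Ys (Imp \<phi> \<psi>) a \<longleftrightarrow> (sat X Ys \<phi> a \<longrightarrow> sat X Ys \<psi> a)"
| "sat X Ys (Iff \<phi> \<psi>) a \<longleftrightarrow> (sat X Ys \<phi> a \<longleftrightarrow> sat X Ys \<psi> a)"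
| "sat X Ys (Forall j \<phi>) a \<longleftrightarrow> (\<forall>x\<in>X. sat X Ys \<phi> (a[j := x]))"
| "sat X Ys (Exists j \<phi>) a \<longleftrightarrow> (\<exists>x\<in>X. sat X Ys \<phi> (a[j := x]))"
| "sat X Ys (ExactlyN b j \<phi>) a \<longleftrightarrow> card {x \<in> X. sat X Ys \<phi> (a[j := x])} = b"

end

theory Submission
  imports Defs
begin

text \<open>
  All representations involved permute their basis labels. Identify a predicate on \<open>X^d\<close> with its
  indicator vector. The tensor product followed by the projection of \<open>U^d \<otimes> U^d\<close> to the diagonal
  multiplies vectors pointwise, which costs exactly degree \<open>2d\<close>; so the functions on \<open>X^d\<close>
  obtained from \<open>2d\<close>-constructible equivariants form an algebra. Summing over the \<open>j\<close>-th coordinate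
  is linear and turns an indicator into a count in \<open>{0..n}\<close>. As \<open>0, \<dots>, n\<close> are distinct in \<open>k\<close>,
  Lagrange interpolation makes every condition on that count polynomial in it.
\<close>

section \<open>Representations permuting their labels\<close>

lemma sum_fun_eq: "(\<Sum>i\<in>I. f i) = (\<lambda>x. \<Sum>i\<in>I. f i x)"
  by (induction I rule: infinite_finite_induct) (auto simp: fun_eq_iff)

lemma inv_in_sym_group: "g \<in> sym_group X \<Longrightarrow> inv g \<in> sym_group X"
  by (simp add: sym_group_def permutes_inv)

lemma comp_in_sym_group: "g \<in> sym_group X \<Longrightarrow> h \<in> sym_group X \<Longrightarrow> g \<circ> h \<in> sym_group X"
  by (simp add: sym_group_def permutes_compose)

lemma id_in_sym_group: "id \<in> sym_group X"
  by (simp add: sym_group_def permutes_id)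

lemma map_label_inv:
  assumes "g \<in> sym_group X"
  shows "map_label (inv g) (map_label g b) = b" "map_label g (map_label (inv g) b) = b"
  using assms permutes_inv_o[of g X]
  by (simp_all add: sym_group_def label.map_comp label.map_id)

lemma map_label_inv_eq_iff:
  assumes "g \<in> sym_group X"
  shows "map_label (inv g) b = c \<longleftrightarrow> b = map_label g c"
  using map_label_inv[OF assms] by metis

text \<open>The permutation representations on labels: \<open>(g v) b = v (inv g b)\<close>. Every
  representation used below has this form, which makes coaction axioms and degrees readable from
  labels. The formula is imposed on \<open>carr V\<close> only, since a coaction may behave
  differently elsewhere.\<close>

definition label_rep :: "'x set \<Rightarrow> ('x, 'k::field) rep \<Rightarrow> bool" where
  "label_rep X V \<longleftrightarrow>
     finite (basis V) \<and>
     (\<forall>g\<in>sym_group X. \<forall>b\<in>basis V. map_label g b \<in> basis V) \<and>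
     (\<forall>v\<in>carr V. coact V v = (\<lambda>(b, g). if g \<in> sym_group X then v (map_label (inv g) b) else 0))"

lemma label_rep_basis_iff:
  assumes "label_rep X V" "g \<in> sym_group X"
  shows "map_label g b \<in> basis V \<longleftrightarrow> b \<in> basis V"
  using assms inv_in_sym_group[OF assms(2)] map_label_inv[OF assms(2)]
  unfolding label_rep_def by metis

lemma label_rep_coact:
  assumes "label_rep X V" "v \<in> carr V"
  shows "coact V v (b, g) = (if g \<in> sym_group X then v (map_label (inv g) b) else 0)"
  using assms by (simp add: label_rep_def)

lemma label_rep_translate:
  assumes "label_rep X V" "v \<in> carr V" "g \<in> sym_group X"
  shows "(\<lambda>b. v (map_label g b)) \<in> carr V"
  using assms label_rep_basis_iff[OF assms(1,3)] by (auto simp: fspace_def)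

lemma zero_in_fspace: "(\<lambda>_. 0) \<in> fspace B"
  by (simp add: fspace_def)

text \<open>Expanding along the finite basis writes \<open>t\<close> as a sum of pure tensors
  \<open>unit_vec b \<otimes> t (b, _)\<close>.\<close>

lemma in_subspace_tensorI:
  fixes t :: "'b \<times> 'c \<Rightarrow> 'k::field"
  assumes "finite B" "\<And>b g. b \<notin> B \<Longrightarrow> t (b, g) = 0" "\<And>b. b \<in> B \<Longrightarrow> (\<lambda>g. t (b, g)) \<in> S"
  shows "t \<in> subspace_tensor (fspace B) S"
proof -
  have "t = (\<Sum>b\<in>B. pure_tensor (unit_vec b) (\<lambda>g. t (b, g)))"
  proof
    fix p :: "'b \<times> 'c"
    obtain b g where p: "p = (b, g)" by force
    have "(\<Sum>b'\<in>B. pure_tensor (unit_vec b') (\<lambda>g. t (b', g))) p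
        = (\<Sum>b'\<in>B. if b = b' then t (b', g) else 0)"
      by (auto simp: sum_fun_eq p pure_tensor_def unit_vec_def intro!: sum.cong)
    then show "t p = (\<Sum>b'\<in>B. pure_tensor (unit_vec b') (\<lambda>g. t (b', g))) p"
      using assms(1,2) by (simp add: p)
  qed
  also have "\<dots> \<in> subspace_tensor (fspace B) S"
    unfolding subspace_tensor_def
    by (intro fvs.span_sum fvs.span_base)
      (use assms(3) in \<open>force simp: fspace_def unit_vec_def\<close>)
  finally show ?thesis .
qed

text \<open>Coassociativity amounts to \<open>inv (g \<circ> h) = inv h \<circ> inv g\<close>, and
  the counit law to \<open>id\<close> fixing every label.\<close>

lemma label_rep_is_rep:
  fixes V :: "('x, 'k::field) rep"
  assumes "label_rep X V"
  shows "is_rep X V"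
  unfolding is_rep_def
proof (intro conjI ballI allI)
  show fin: "finite (basis V)"
    using assms by (simp add: label_rep_def)
  show "linear_between (carr V) (subspace_tensor (carr V) (coord_ring X)) (coact V)"
    unfolding linear_between_def
  proof (intro conjI ballI allI)
    fix v :: "('x, 'k) vec" assume v: "v \<in> carr V"
    show "coact V v \<in> subspace_tensor (carr V) (coord_ring X)"
    proof (rule in_subspace_tensorI[OF fin])
      show "coact V v (b, g) = 0" if "b \<notin> basis V" for b g
        using that v label_rep_basis_iff[OF assms inv_in_sym_group, of g b]
        by (simp add: label_rep_coact[OF assms v]) (simp add: fspace_def)
      show "(\<lambda>g. coact V v (b, g)) \<in> coord_ring X" for b
        by (simp add: label_rep_coact[OF assms v] fspace_def)
    qed
    fix c
    have "fscale c v \<in> carr V" using v by (simp add: fspace_def fscale_def)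
    then show "coact V (fscale c v) = fscale c (coact V v)"
      using v by (auto simp: fun_eq_iff label_rep_coact[OF assms] fscale_def)
  next
    fix u v :: "('x, 'k) vec" assume uv: "u \<in> carr V" "v \<in> carr V"
    then have "u + v \<in> carr V" by (simp add: fspace_def)
    then show "coact V (u + v) = coact V u + coact V v"
      using uv by (auto simp: fun_eq_iff label_rep_coact[OF assms])
  qed
next
  fix v :: "('x, 'k) vec" and b and g h :: "'x \<Rightarrow> 'x"
  assume v: "v \<in> carr V"
  \<comment> \<open>The coaction formula applies to this slice only once it is known to lie in the
    carrier; for \<open>h\<close> outside the group the slice is zero.\<close>
  have "(\<lambda>a. coact V v (a, h)) \<in> carr V"
    using label_rep_translate[OF assms v inv_in_sym_group, of h]
    by (cases "h \<in> sym_group X") (simp_all add: label_rep_coact[OF assms v] zero_in_fspace)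
  moreover have "inv (g \<circ> h) = inv h \<circ> inv g" if "g \<in> sym_group X" "h \<in> sym_group X"
    using that by (intro o_inv_distrib) (auto simp: sym_group_def permutes_bij)
  ultimately show "map_left (coact V) (coact V v) ((b, g), h)
      = map_right (comult X) (coact V v) (b, (g, h))"
    by (auto simp: map_left_def map_right_def comult_def label_rep_coact[OF assms] v
        comp_in_sym_group label.map_comp)
next
  fix v :: "('x, 'k) vec" and b
  assume "v \<in> carr V"
  then show "counit (\<lambda>g. coact V v (b, g)) = v b"
    by (simp add: counit_def label_rep_coact[OF assms] id_in_sym_group label.map_id)
qed

section \<open>The concrete representations\<close>

lemma finite_words: "finite X \<Longrightarrow> finite (words X m)"
  unfolding words_def by (rule finite_lists_length_eq)

lemma map_in_words_iff:
  assumes "g \<in> sym_group X"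
  shows "map g w \<in> words X m \<longleftrightarrow> w \<in> words X m"
  using assms by (auto simp: words_def sym_group_def permutes_in_image)

lemma label_rep_trivial_rep: "label_rep X (trivial_rep X :: ('x, 'k::field) rep)"
  unfolding label_rep_def
proof (intro conjI ballI)
  fix v :: "('x, 'k) vec"
  assume "v \<in> carr (trivial_rep X)"
  \<comment> \<open>Relabelling fixes \<open>Pt\<close> and keeps every other label different from
    \<open>Pt\<close>, where \<open>v\<close> vanishes.\<close>
  then have "v b = v (map_label g b)" for b and g :: "'x \<Rightarrow> 'x"
    by (cases b) (auto simp: trivial_rep_def fspace_def)
  then show "coact (trivial_rep X) v =
      (\<lambda>(b, g). if g \<in> sym_group X then v (map_label (inv g) b) else 0)"
    by (auto simp: trivial_rep_def pure_tensor_def ring_one_def fun_eq_iff)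
qed (auto simp: trivial_rep_def)

lemma label_rep_tensor_power:
  assumes "finite X"
  shows "label_rep X (tensor_power X m :: ('x, 'k::field) rep)"
  unfolding label_rep_def
proof (intro conjI ballI)
  fix v :: "('x, 'k) vec"
  assume v: "v \<in> carr (tensor_power X m)"
  have "(\<Sum>w\<in>words X m. v (Word w) * unit_vec (Word (map g w)) b) = v (map_label (inv g) b)"
    if g: "g \<in> sym_group X" for b g
  proof -
    have "(\<Sum>w\<in>words X m. v (Word w) * unit_vec (Word (map g w)) b)
        = (\<Sum>c\<in>Word ` words X m. v c * unit_vec (map_label g c) b)"
      by (simp add: sum.reindex inj_on_def)
    also have "\<dots> = (\<Sum>c\<in>Word ` words X m. if map_label (inv g) b = c then v c else 0)"
      by (intro sum.cong) (auto simp: unit_vec_def map_label_inv_eq_iff[OF g])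
    \<comment> \<open>If the selected label is not a basis word, no term survives, and
      \<open>v\<close> vanishes there as well.\<close>
    also have "\<dots> = v (map_label (inv g) b)"
      using v finite_words[OF assms, of m] by (auto simp: tensor_power_def fspace_def)
    finally show ?thesis .
  qed
  then show "coact (tensor_power X m) v =
      (\<lambda>(b, g). if g \<in> sym_group X then v (map_label (inv g) b) else 0)"
    by (auto simp: tensor_power_def fun_eq_iff)
qed (use finite_words[OF assms] in \<open>auto simp: tensor_power_def map_in_words_iff\<close>)

lemma label_rep_sum_rep:
  fixes V V' :: "('x, 'k::field) rep"
  assumes "label_rep X V" "label_rep X V'"
  shows "label_rep X (sum_rep V V')"
  unfolding label_rep_def
proof (intro conjI ballI)
  show "finite (basis (sum_rep V V'))"
    using assms by (simp add: label_rep_def sum_rep_def)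
  show "map_label g b \<in> basis (sum_rep V V')"
    if "g \<in> sym_group X" "b \<in> basis (sum_rep V V')" for g b
    using that assms by (auto simp: label_rep_def sum_rep_def)
  fix v :: "('x, 'k) vec"
  assume v: "v \<in> carr (sum_rep V V')"
  have "proj_l v \<in> carr V" "proj_r v \<in> carr V'"
    using v by (auto simp: fspace_def sum_rep_def proj_l_def proj_r_def)
  note co = label_rep_coact[OF assms(1) this(1)] label_rep_coact[OF assms(2) this(2)]
  have "coact (sum_rep V V') v (b, g) =
      (if g \<in> sym_group X then v (map_label (inv g) b) else 0)" for b g
    using v
    by (cases b; simp add: sum_rep_def co)
      (auto simp: fspace_def proj_l_def proj_r_def)
  then show "coact (sum_rep V V') v =
      (\<lambda>(b, g). if g \<in> sym_group X then v (map_label (inv g) b) else 0)"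
    by auto
qed

lemma label_rep_tensor_rep:
  fixes V V' :: "('x, 'k::field) rep"
  assumes "label_rep X V" "label_rep X V'"
  shows "label_rep X (tensor_rep V V')"
  unfolding label_rep_def
proof (intro conjI ballI)
  have fin: "finite (basis V)" "finite (basis V')"
    using assms by (auto simp: label_rep_def)
  have bas: "basis (tensor_rep V V') = (\<lambda>(b, c). Pr b c) ` (basis V \<times> basis V')"
    by (auto simp: tensor_rep_def)
  show "finite (basis (tensor_rep V V'))"
    using fin by (simp add: bas)
  show "map_label g b \<in> basis (tensor_rep V V')"
    if "g \<in> sym_group X" "b \<in> basis (tensor_rep V V')" for g b
    using that assms by (auto simp: label_rep_def tensor_rep_def)
  fix t :: "('x, 'k) vec"
  assume t: "t \<in> carr (tensor_rep V V')"
  \<comment> \<open>A translated basis vector is again a basis vector, so each factor of the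
    coaction is a Kronecker delta.\<close>
  have co: "coact V (unit_vec b) (b', g) =
        (if g \<in> sym_group X \<and> map_label (inv g) b' = b then 1 else 0)"
    if "b \<in> basis V" for b b' g
    using that by (subst label_rep_coact[OF assms(1)]) (auto simp: fspace_def unit_vec_def)
  have co': "coact V' (unit_vec b) (b', g) =
        (if g \<in> sym_group X \<and> map_label (inv g) b' = b then 1 else 0)"
    if "b \<in> basis V'" for b b' g
    using that by (subst label_rep_coact[OF assms(2)]) (auto simp: fspace_def unit_vec_def)
  have "coact (tensor_rep V V') t (a, g) =
      (if g \<in> sym_group X then t (map_label (inv g) a) else 0)" for a g
  proof (cases "\<exists>b' c'. a = Pr b' c'")
    case False
    then show ?thesis
      using t by (cases a) (auto simp: tensor_rep_def fspace_def)
  next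
    case True
    then obtain b' c' where a: "a = Pr b' c'" by blast
    have "coact (tensor_rep V V') t (a, g) = (\<Sum>b\<in>basis V. \<Sum>c\<in>basis V'.
        if g \<in> sym_group X \<and> map_label (inv g) c' = c
        then (if map_label (inv g) b' = b then t (Pr b c) else 0) else 0)"
      unfolding a by (auto simp: tensor_rep_def co co' intro!: sum.cong)
    \<comment> \<open>One delta selects \<open>c\<close>, the other \<open>b\<close>; when a
      selected label lies outside its basis, \<open>t\<close> vanishes at the corresponding
      pair.\<close>
    also have "\<dots> = (if g \<in> sym_group X then t (map_label (inv g) a) else 0)"
      using t fin
      by (cases "map_label (inv g) c' \<in> basis V'") (auto simp: a tensor_rep_def fspace_def)
    finally show ?thesis .
  qed
  then show "coact (tensor_rep V V') t =
      (\<lambda>(b, g). if g \<in> sym_group X then t (map_label (inv g) b) else 0)"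
    by auto
qed

lemma label_rep_structure_rep:
  "finite X \<Longrightarrow> label_rep X (structure_rep X ms :: ('x, 'k::field) rep)"
  by (induction ms) (simp_all add: label_rep_trivial_rep label_rep_sum_rep label_rep_tensor_power)

text \<open>Evaluated at a group element, equivariance says that \<open>f\<close> commutes with
  translation of labels; applying the premise to \<open>inv g\<close> gives the coaction
  form.\<close>

lemma label_rep_equivariantI:
  fixes f :: "('x, 'k::field) vec \<Rightarrow> ('x, 'k) vec"
  assumes "label_rep X V" "label_rep X V'" "linear_between (carr V) (carr V') f"
    and "\<And>v g. v \<in> carr V \<Longrightarrow> g \<in> sym_group X \<Longrightarrow>
      f (\<lambda>b. v (map_label g b)) = (\<lambda>b. f v (map_label g b))"
  shows "equivariant_linear V V' f"
  unfolding equivariant_linear_def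
proof (intro conjI ballI assms(3))
  fix v :: "('x, 'k) vec"
  assume v: "v \<in> carr V"
  then have fv: "f v \<in> carr V'"
    using assms(3) by (simp add: linear_between_def)
  \<comment> \<open>Outside the group the coaction is zero, and the two sides agree there because
    \<open>f\<close> sends zero to zero.\<close>
  have "f (fscale 0 v) = fscale 0 (f v)"
    using assms(3) v unfolding linear_between_def by blast
  then have "f (\<lambda>_. 0) = (\<lambda>_. 0)"
    by (simp add: fscale_def)
  then show "coact V' (f v) = map_left f (coact V v)"
    by (auto simp: fun_eq_iff map_left_def label_rep_coact[OF assms(1) v]
        label_rep_coact[OF assms(2) fv] assms(4)[OF v inv_in_sym_group])
qed

section \<open>Degrees\<close>

text \<open>Entry \<open>(b, c)\<close> of the matrix of \<open>g\<close> in the label basis,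
  extending \<open>mat_coeff\<close> from letters to labels.\<close>

definition label_coeff :: "'x set \<Rightarrow> 'x label \<Rightarrow> 'x label \<Rightarrow> ('x \<Rightarrow> 'x) \<Rightarrow> 'k::field" where
  "label_coeff X b c = (\<lambda>g. if g \<in> sym_group X \<and> map_label g c = b then 1 else 0)"

lemma subspace_filtration: "fvs.subspace (filtration X l)"
  by (cases l) simp_all

text \<open>Each slice of the coaction at a basis label is a linear combination of matrix
  coefficients, and a filtration step is a subspace; so step \<open>l\<close> is a candidate for the
  least one.\<close>

lemma ell_leI:
  fixes V :: "('x, 'k::field) rep"
  assumes "label_rep X V"
    and "\<And>b c. b \<in> basis V \<Longrightarrow> c \<in> basis V \<Longrightarrow>
      (label_coeff X b c :: _ \<Rightarrow> 'k) \<in> filtration X l"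
  shows "ell X V \<le> l"
  unfolding ell_def
proof (rule Least_le, rule image_subsetI)
  fix v :: "('x, 'k) vec"
  assume v: "v \<in> carr V"
  have fin: "finite (basis V)"
    using assms(1) by (simp add: label_rep_def)
  show "coact V v \<in> subspace_tensor (carr V) (filtration X l)"
  proof (rule in_subspace_tensorI[OF fin])
    show "coact V v (b, g) = 0" if "b \<notin> basis V" for b g
      using that v label_rep_basis_iff[OF assms(1) inv_in_sym_group, of g b]
      by (simp add: label_rep_coact[OF assms(1) v]) (simp add: fspace_def)
    fix b assume b: "b \<in> basis V"
    have "(\<lambda>g. coact V v (b, g)) = (\<Sum>c\<in>basis V. fscale (v c) (label_coeff X b c))"
    proof
      fix g
      have "(\<Sum>c\<in>basis V. fscale (v c) (label_coeff X b c)) g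
          = (\<Sum>c\<in>basis V. if map_label (inv g) b = c
              then (if g \<in> sym_group X then v c else 0) else 0)"
        by (auto simp: sum_fun_eq fscale_def label_coeff_def map_label_inv_eq_iff intro!: sum.cong)
      also have "\<dots> = coact V v (b, g)"
        using fin v by (auto simp: label_rep_coact[OF assms(1) v] fspace_def)
      finally show "coact V v (b, g) = (\<Sum>c\<in>basis V. fscale (v c) (label_coeff X b c)) g" ..
    qed
    then show "(\<lambda>g. coact V v (b, g)) \<in> filtration X l"
      using assms(2) b
      by (auto intro!: fvs.subspace_sum fvs.subspace_scale subspace_filtration)
  qed
qed

text \<open>A group element acts letter by letter, so the coefficient of two words is a product of
  letter coefficients, one factor from \<open>gen_space\<close> per position. The empty words give
  the constant 1.\<close>

lemma label_coeff_Word: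
  assumes "u \<in> words X m" "w \<in> words X m"
  shows "(label_coeff X (Word u) (Word w) :: _ \<Rightarrow> 'k::field) \<in> filtration X m"
  using assms
proof (induction m arbitrary: u w)
  case 0
  then have "label_coeff X (Word u) (Word w) = (ring_one X :: _ \<Rightarrow> 'k)"
    by (auto simp: words_def label_coeff_def ring_one_def)
  then show ?case
    by (simp add: fvs.span_base)
next
  case (Suc m)
  then obtain x u' y w' where *: "u = x # u'" "w = y # w'" "x \<in> X" "y \<in> X"
      "u' \<in> words X m" "w' \<in> words X m"
    by (auto simp: words_def length_Suc_conv)
  have "label_coeff X (Word u) (Word w)
      = (mat_coeff X x y * label_coeff X (Word u') (Word w') :: _ \<Rightarrow> 'k)"
    by (auto simp: * label_coeff_def mat_coeff_def fun_eq_iff)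
  moreover have "(mat_coeff X x y :: _ \<Rightarrow> 'k) \<in> gen_space X"
    unfolding gen_space_def using * by (intro fvs.span_base) blast
  ultimately show ?case
    using Suc.IH[OF *(5,6)] unfolding filtration.simps by (intro fvs.span_base) blast
qed

lemma ell_tensor_power:
  "finite X \<Longrightarrow> ell X (tensor_power X m :: ('x, 'k::field) rep) \<le> m"
  by (rule ell_leI[OF label_rep_tensor_power])
    (auto simp: tensor_power_def label_coeff_Word)

text \<open>No group element moves a label of one summand into the other, so mixed coefficients
  vanish and the rest are coefficients of a single summand.\<close>

lemma ell_sum_tensor_power:
  assumes "finite X"
  shows "ell X (sum_rep (tensor_power X m) (tensor_power X m) :: ('x, 'k::field) rep) \<le> m"
proof (rule ell_leI)
  fix b c
  assume "b \<in> basis (sum_rep (tensor_power X m) (tensor_power X m) :: ('x, 'k) rep)"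
    and "c \<in> basis (sum_rep (tensor_power X m) (tensor_power X m) :: ('x, 'k) rep)"
  then obtain u w where uw: "u \<in> words X m" "w \<in> words X m"
    and bc: "b = InL (Word u) \<or> b = InR (Word u)" "c = InL (Word w) \<or> c = InR (Word w)"
    by (auto simp: sum_rep_def tensor_power_def)
  have "label_coeff X b c = (label_coeff X (Word u) (Word w) :: _ \<Rightarrow> 'k) \<or>
      label_coeff X b c = (0 :: _ \<Rightarrow> 'k)"
    using bc by (auto simp: label_coeff_def fun_eq_iff)
  then show "(label_coeff X b c :: _ \<Rightarrow> 'k) \<in> filtration X m"
    using label_coeff_Word[OF uw] fvs.subspace_0[OF subspace_filtration] by metis
qed (use assms in \<open>intro label_rep_sum_rep label_rep_tensor_power\<close>)

lemma ell_tensor_tensor_power: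
  assumes "finite X"
  shows "ell X (tensor_rep (tensor_power X l) (tensor_power X m) :: ('x, 'k::field) rep) \<le> l + m"
proof (rule ell_leI)
  fix b c
  assume "b \<in> basis (tensor_rep (tensor_power X l) (tensor_power X m) :: ('x, 'k) rep)"
    and "c \<in> basis (tensor_rep (tensor_power X l) (tensor_power X m) :: ('x, 'k) rep)"
  then obtain u u' w w' where *: "u \<in> words X l" "w \<in> words X l" "u' \<in> words X m" "w' \<in> words X m"
      "b = Pr (Word u) (Word u')" "c = Pr (Word w) (Word w')"
    by (auto simp: tensor_rep_def tensor_power_def)
  \<comment> \<open>Since \<open>u\<close> and \<open>w\<close> have the same length,
    \<open>map g (w @ w') = u @ u'\<close> splits into the equations of the two factors.\<close>
  then have "label_coeff X b c = (label_coeff X (Word (u @ u')) (Word (w @ w')) :: _ \<Rightarrow> 'k)"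
    by (auto simp: label_coeff_def fun_eq_iff words_def)
  moreover have "u @ u' \<in> words X (l + m)" "w @ w' \<in> words X (l + m)"
    using * by (auto simp: words_def)
  ultimately show "(label_coeff X b c :: _ \<Rightarrow> 'k) \<in> filtration X (l + m)"
    by (simp add: label_coeff_Word)
qed (use assms in \<open>intro label_rep_tensor_rep label_rep_tensor_power\<close>)

section \<open>Functions on words obtained from constructible equivariants\<close>

text \<open>Encodes a function on \<open>X^d\<close> as a vector of the \<open>d\<close>-th tensor
  power; the truth set of a formula becomes its indicator.\<close>

definition word_vec :: "'x set \<Rightarrow> nat \<Rightarrow> ('x list \<Rightarrow> 'k::field) \<Rightarrow> ('x, 'k) vec" where
  "word_vec X d F = (\<lambda>b. case b of Word a \<Rightarrow> if a \<in> words X d then F a else 0 | _ \<Rightarrow> 0)"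

lemma word_vec_simps [simp]:
  "word_vec X d F (Word a) = (if a \<in> words X d then F a else 0)"
  "word_vec X d F Pt = 0" "word_vec X d F (InL b) = 0"
  "word_vec X d F (InR b) = 0" "word_vec X d F (Pr b c) = 0"
  by (simp_all add: word_vec_def)

lemma word_vec_cong:
  "(\<And>a. a \<in> words X d \<Longrightarrow> F a = F' a) \<Longrightarrow> word_vec X d F = word_vec X d F'"
  by (auto simp: word_vec_def fun_eq_iff split: label.split)

lemma word_vec_add: "word_vec X d F + word_vec X d F' = word_vec X d (\<lambda>a. F a + F' a)"
  by (auto simp: word_vec_def fun_eq_iff split: label.split)

lemma fscale_word_vec: "fscale c (word_vec X d F) = word_vec X d (\<lambda>a. c * F a)"
  by (auto simp: word_vec_def fscale_def fun_eq_iff split: label.split)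

text \<open>Source of the linear generators into a tensor power: it suffices to give coordinate
  functionals \<open>F _ a\<close> that are linear and satisfy
  \<open>F (inv g v) a = F v (g a)\<close>.\<close>

lemma constructible_word_vec:
  fixes V :: "('x, 'k::field) rep" and F :: "('x, 'k) vec \<Rightarrow> 'x list \<Rightarrow> 'k"
  assumes "finite X" "label_rep X V" "ell X V \<le> e" "d \<le> e"
    and "\<And>u v a. F (u + v) a = F u a + F v a"
    and "\<And>c v a. F (fscale c v) a = c * F v a"
    and "\<And>v g a. g \<in> sym_group X \<Longrightarrow> a \<in> words X d \<Longrightarrow>
      F (\<lambda>b. v (map_label g b)) a = F v (map g a)"
  shows "constructible X e V (tensor_power X d) (\<lambda>v. word_vec X d (F v))"
proof (rule constructible.linear)
  show "is_rep X V" "is_rep X (tensor_power X d :: ('x, 'k) rep)"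
    using assms(1,2) by (simp_all add: label_rep_is_rep label_rep_tensor_power)
  show "ell X (tensor_power X d :: ('x, 'k) rep) \<le> e"
    using ell_tensor_power[OF assms(1), of d] assms(4) by (rule order_trans)
  show "equivariant_linear V (tensor_power X d) (\<lambda>v. word_vec X d (F v))"
  proof (rule label_rep_equivariantI[OF assms(2) label_rep_tensor_power[OF assms(1)]])
    show "linear_between (carr V) (carr (tensor_power X d)) (\<lambda>v. word_vec X d (F v))"
      unfolding linear_between_def
    proof (intro conjI ballI allI)
      show "word_vec X d (F v) \<in> carr (tensor_power X d)" for v
        by (auto simp: tensor_power_def fspace_def word_vec_def split: label.split)
    qed (auto simp: assms(5,6) word_vec_add fscale_word_vec intro!: word_vec_cong)
    show "word_vec X d (F (\<lambda>b. v (map_label g b))) = (\<lambda>b. word_vec X d (F v) (map_label g b))"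
      if g: "g \<in> sym_group X" for v g
    proof
      show "word_vec X d (F (\<lambda>b. v (map_label g b))) b = word_vec X d (F v) (map_label g b)" for b
        by (cases b) (simp_all add: assms(7) g map_in_words_iff[OF g])
    qed
  qed
qed fact

text \<open>The map \<open>f\<close> is chosen before the structure, so one equivariant computes
  \<open>F\<close> uniformly and further equivariants can be composed after it.\<close>

definition representable ::
  "'x set \<Rightarrow> nat \<Rightarrow> nat list \<Rightarrow> ('x list set list \<Rightarrow> 'x list \<Rightarrow> 'k::field) \<Rightarrow> bool" where
  "representable X d ms F \<longleftrightarrow> (\<exists>f :: ('x, 'k) vec \<Rightarrow> ('x, 'k) vec.
     constructible X (2 * d) (structure_rep X ms) (tensor_power X d) f \<and>
     (\<forall>Ys. is_structure X ms Ys \<longrightarrow> f (structure_vec Ys) = word_vec X d (F Ys)))"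

section \<open>Closure properties of representable functions\<close>

lemma representable_cong:
  assumes "representable X d ms F"
    and "\<And>Ys a. is_structure X ms Ys \<Longrightarrow> a \<in> words X d \<Longrightarrow> F Ys a = F' Ys a"
  shows "representable X d ms F'"
  using assms word_vec_cong[of X d "F _" "F' _"] unfolding representable_def by metis

lemma representable_lincomb:
  assumes "representable X d ms F" "representable X d ms F'"
  shows "representable X d ms (\<lambda>Ys a. c * F Ys a + c' * F' Ys a)"
proof -
  obtain f f' where "constructible X (2 * d) (structure_rep X ms) (tensor_power X d) f"
      "constructible X (2 * d) (structure_rep X ms) (tensor_power X d) f'"
    and *: "\<And>Ys. is_structure X ms Ys \<Longrightarrow> f (structure_vec Ys) = word_vec X d (F Ys)"
      "\<And>Ys. is_structure X ms Ys \<Longrightarrow> f' (structure_vec Ys) = word_vec X d (F' Ys)"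
    using assms unfolding representable_def by blast
  then have "constructible X (2 * d) (structure_rep X ms) (tensor_power X d)
      (\<lambda>v. fscale c (f v) + fscale c' (f' v))"
    by (intro constructible.lincomb)
  then show ?thesis
    unfolding representable_def
    by (intro exI[of _ "\<lambda>v. fscale c (f v) + fscale c' (f' v)"] conjI)
      (simp_all add: * word_vec_add fscale_word_vec)
qed

text \<open>For \<open>(p, q)\<close> equal to \<open>(1, 0)\<close> and \<open>(0, 1)\<close> these
  are the two inclusions into the direct sum; they serve to pair two maps with a common
  source.\<close>

lemma constructible_into_sum:
  assumes "finite X" "m \<le> e"
  shows "constructible X e (tensor_power X m)
    (sum_rep (tensor_power X m) (tensor_power X m) :: ('x, 'k::field) rep) (\<lambda>v. sum_vec (fscale p v) (fscale q v))"
proof (rule constructible.linear)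
  let ?T = "tensor_power X m :: ('x, 'k) rep"
  have T: "label_rep X ?T" "label_rep X (sum_rep ?T ?T)"
    using assms(1) by (simp_all add: label_rep_sum_rep label_rep_tensor_power)
  show "is_rep X ?T" "is_rep X (sum_rep ?T ?T)"
    using T by (simp_all add: label_rep_is_rep)
  show "ell X ?T \<le> e" "ell X (sum_rep ?T ?T) \<le> e"
    using ell_tensor_power[OF assms(1), of m] ell_sum_tensor_power[OF assms(1), of m] assms(2)
    by (meson order_trans)+
  \<comment> \<open>\<open>sum_vec\<close> is defined by cases on the label, so equality is checked
    constructor by constructor.\<close>
  have ext: "v = w" if "\<And>b. v (InL b) = w (InL b)" "\<And>b. v (InR b) = w (InR b)"
      "v Pt = w Pt" "\<And>b. v (Word b) = w (Word b)" "\<And>b c. v (Pr b c) = w (Pr b c)"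
    for v w :: "('x, 'k) vec"
    using that by (metis ext label.exhaust)
  show "equivariant_linear ?T (sum_rep ?T ?T) (\<lambda>v. sum_vec (fscale p v) (fscale q v))"
  proof (rule label_rep_equivariantI[OF T])
    show "linear_between (carr ?T) (carr (sum_rep ?T ?T)) (\<lambda>v. sum_vec (fscale p v) (fscale q v))"
      unfolding linear_between_def
    proof (intro conjI ballI allI)
      fix v :: "('x, 'k) vec" assume v: "v \<in> carr ?T"
      show "sum_vec (fscale p v) (fscale q v) \<in> carr (sum_rep ?T ?T)"
        unfolding fspace_def
      proof (intro CollectI allI impI)
        show "sum_vec (fscale p v) (fscale q v) b = 0" if "b \<notin> basis (sum_rep ?T ?T)" for b
          using that v by (cases b) (auto simp: sum_rep_def fspace_def fscale_def)
      qed
    qed (auto intro!: ext simp: fscale_def algebra_simps)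
  qed (auto intro!: ext simp: fscale_def)
qed

lemma representable_mult:
  fixes F F' :: "'x list set list \<Rightarrow> 'x list \<Rightarrow> 'k::field"
  assumes "finite X" "representable X d ms F" "representable X d ms F'"
  shows "representable X d ms (\<lambda>Ys a. F Ys a * F' Ys a)"
proof -
  let ?T = "tensor_power X d :: ('x, 'k) rep"
  obtain f f' where f: "constructible X (2 * d) (structure_rep X ms) ?T f"
      "constructible X (2 * d) (structure_rep X ms) ?T f'"
    and *: "\<And>Ys. is_structure X ms Ys \<Longrightarrow> f (structure_vec Ys) = word_vec X d (F Ys)"
      "\<And>Ys. is_structure X ms Ys \<Longrightarrow> f' (structure_vec Ys) = word_vec X d (F' Ys)"
    using assms unfolding representable_def by blast
  \<comment> \<open>Pairing \<open>f\<close> with \<open>f'\<close> is not a generator; it arises as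
    the sum of their composites with the two inclusions.\<close>
  let ?pair = "\<lambda>v. fscale 1 (((\<lambda>v. sum_vec (fscale 1 v) (fscale 0 v)) \<circ> f) v)
      + fscale 1 (((\<lambda>v. sum_vec (fscale 0 v) (fscale 1 v)) \<circ> f') v)"
  \<comment> \<open>Reading the diagonal coordinates turns the outer product of two vectors into
    their pointwise product.\<close>
  let ?diag = "\<lambda>t. word_vec X d (\<lambda>a. t (Pr (Word a) (Word a)))"
  have pair: "constructible X (2 * d) (structure_rep X ms) (sum_rep ?T ?T) ?pair"
    using f assms(1)
    by (intro constructible.lincomb constructible.comp[OF _ constructible_into_sum]) auto
  \<comment> \<open>Each factor has degree at most \<open>d\<close>, so the sum of the degrees stays
    within \<open>2 * d\<close>.\<close>
  have tens: "constructible X (2 * d) (sum_rep ?T ?T) (tensor_rep ?T ?T)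
      (\<lambda>v. tensor_vec (proj_l v) (proj_r v))"
    using ell_tensor_power[OF assms(1), of d, where 'k = 'k] assms(1)
    by (intro constructible.tensor label_rep_is_rep label_rep_tensor_power) auto
  have "ell X (tensor_rep ?T ?T) \<le> 2 * d"
    using ell_tensor_tensor_power[OF assms(1), of d d, where 'k = 'k] by (simp add: mult_2)
  then have diag: "constructible X (2 * d) (tensor_rep ?T ?T) ?T ?diag"
    using assms(1)
    by (intro constructible_word_vec label_rep_tensor_rep label_rep_tensor_power)
      (auto simp: fscale_def)
  have "(?diag \<circ> ((\<lambda>v. tensor_vec (proj_l v) (proj_r v)) \<circ> ?pair)) (structure_vec Ys)
      = word_vec X d (\<lambda>a. F Ys a * F' Ys a)" if "is_structure X ms Ys" for Ys
    using that by (auto simp: * fscale_def proj_l_def proj_r_def intro!: word_vec_cong)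
  then show ?thesis
    using constructible.comp[OF constructible.comp[OF pair tens] diag]
    unfolding representable_def by blast
qed

text \<open>Summation commutes with the action because \<open>g\<close> permutes \<open>X\<close>
  and the sum can be reindexed. For \<open>j < d\<close> the result is constant in coordinate
  \<open>j\<close>, so the arity stays \<open>d\<close> and the variable remains available for
  reuse.\<close>

lemma representable_sum_coord:
  fixes F :: "'x list set list \<Rightarrow> 'x list \<Rightarrow> 'k::field"
  assumes "finite X" "representable X d ms F"
  shows "representable X d ms (\<lambda>Ys a. \<Sum>x\<in>X. F Ys (a[j := x]))"
proof -
  obtain f where f: "constructible X (2 * d) (structure_rep X ms) (tensor_power X d) f"
    and *: "\<And>Ys. is_structure X ms Ys \<Longrightarrow> f (structure_vec Ys) = word_vec X d (F Ys)"
    using assms unfolding representable_def by blast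
  let ?s = "\<lambda>v :: ('x, 'k) vec. word_vec X d (\<lambda>a. \<Sum>x\<in>X. v (Word (a[j := x])))"
  have s: "constructible X (2 * d) (tensor_power X d) (tensor_power X d) ?s"
  proof (rule constructible_word_vec[OF assms(1) label_rep_tensor_power[OF assms(1)]])
    show "ell X (tensor_power X d :: ('x, 'k) rep) \<le> 2 * d"
      using ell_tensor_power[OF assms(1), of d, where 'k = 'k] by simp
    fix v :: "('x, 'k) vec" and g a
    assume "g \<in> sym_group X"
    then have "bij_betw g X X"
      by (simp add: sym_group_def permutes_imp_bij)
    from sum.reindex_bij_betw[OF this, of "\<lambda>x. v (Word ((map g a)[j := x]))"]
    show "(\<Sum>x\<in>X. v (map_label g (Word (a[j := x])))) = (\<Sum>x\<in>X. v (Word ((map g a)[j := x])))"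
      by (simp add: map_update)
  qed (auto simp: fscale_def sum.distrib sum_distrib_left)
  have "a[j := x] \<in> words X d" if "a \<in> words X d" "x \<in> X" for a x
    using that set_update_subset_insert[of a j x] by (auto simp: words_def)
  then have "(?s \<circ> f) (structure_vec Ys) = word_vec X d (\<lambda>a. \<Sum>x\<in>X. F Ys (a[j := x]))"
    if "is_structure X ms Ys" for Ys
    using that by (auto simp: * intro!: word_vec_cong sum.cong)
  then show ?thesis
    using constructible.comp[OF f s] unfolding representable_def by blast
qed

section \<open>Atomic formulas\<close>

lemma structure_vec_Pt: "structure_vec Ys ((InR ^^ length Ys) Pt) = 1"
  by (induction Ys) (simp_all add: unit_vec_def)

text \<open>The direct sums nest to the right: summand \<open>i\<close> sits behind \<open>i\<close>
  copies of \<open>InR\<close> and one \<open>InL\<close>, the final trivial summand behind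
  \<open>length Ys\<close> copies of \<open>InR\<close>.\<close>

lemma structure_vec_InL:
  "i < length Ys \<Longrightarrow> structure_vec Ys ((InR ^^ i) (InL b)) = tensor (Ys ! i) b"
  by (induction Ys arbitrary: i) (auto simp: nth_Cons split: nat.split)

lemma map_label_InR_power: "map_label g ((InR ^^ i) b) = (InR ^^ i) (map_label g b)"
  by (induction i) simp_all

lemma tensor_Word:
  assumes "finite Y"
  shows "tensor Y (Word w) = (if w \<in> Y then 1 else 0)"
  using assms by (simp add: tensor_def sum_fun_eq unit_vec_def)

lemma tensor_eq_word_vec:
  assumes "finite X" "Y \<subseteq> words X d"
  shows "tensor Y = word_vec X d (\<lambda>a. if a \<in> Y then 1 else 0)"
proof
  fix b
  have "finite Y"
    using assms finite_words finite_subset by blast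
  then show "tensor Y b = word_vec X d (\<lambda>a. if a \<in> Y then 1 else 0) b"
    using assms(2) by (cases b) (auto simp: tensor_def sum_fun_eq unit_vec_def)
qed

text \<open>The indicator does not depend on the relations; a linear map obtains it by scaling with
  the trivial coordinate, which is 1 on every structure vector. Equivariance comes from injectivity
  of \<open>g\<close>.\<close>

lemma representable_Eq:
  assumes "finite X" "ell X (structure_rep X ms :: ('x, 'k::field) rep) \<le> 2 * d" "i < d" "j < d"
  shows "representable X d ms (\<lambda>Ys (a :: 'x list). if a ! i = a ! j then 1 else 0 :: 'k)"
proof -
  let ?f = "\<lambda>v :: ('x, 'k) vec. word_vec X d (\<lambda>a. if a ! i = a ! j then v ((InR ^^ length ms) Pt) else 0)"
  have "constructible X (2 * d) (structure_rep X ms) (tensor_power X d) ?f"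
  proof (rule constructible_word_vec[OF assms(1) label_rep_structure_rep[OF assms(1)] assms(2)])
    fix v :: "('x, 'k) vec" and g a
    assume g: "g \<in> sym_group X" and a: "a \<in> words X d"
    have "inj g"
      using g by (simp add: sym_group_def permutes_inj)
    then show "(if a ! i = a ! j then v (map_label g ((InR ^^ length ms) Pt)) else 0) =
        (if map g a ! i = map g a ! j then v ((InR ^^ length ms) Pt) else 0)"
      using a assms(3,4) by (simp add: map_label_InR_power words_def inj_eq)
  qed (auto simp: fscale_def)
  moreover have "?f (structure_vec Ys) = word_vec X d (\<lambda>a. if a ! i = a ! j then 1 else 0)"
    if "is_structure X ms Ys" for Ys
    using that structure_vec_Pt[of Ys]
    by (auto simp: is_structure_def list_all2_lengthD intro!: word_vec_cong)
  ultimately show ?thesis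
    unfolding representable_def by blast
qed

text \<open>Substituting variables is linear: it reads the coordinate of relation \<open>i\<close>
  at the word formed from \<open>a\<close>. Repeated or permuted variables in \<open>js\<close>
  merely select other coordinates.\<close>

lemma representable_Rel:
  assumes "finite X" "ell X (structure_rep X ms :: ('x, 'k::field) rep) \<le> 2 * d"
    and "i < length ms" "\<forall>j\<in>set js. j < d"
  shows "representable X d ms (\<lambda>Ys (a :: 'x list). if map (\<lambda>j. a ! j) js \<in> Ys ! i then 1 else 0 :: 'k)"
proof -
  let ?f = "\<lambda>v :: ('x, 'k) vec. word_vec X d (\<lambda>a. v ((InR ^^ i) (InL (Word (map (\<lambda>j. a ! j) js)))))"
  have "constructible X (2 * d) (structure_rep X ms) (tensor_power X d) ?f"
  proof (rule constructible_word_vec[OF assms(1) label_rep_structure_rep[OF assms(1)] assms(2)])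
    fix v :: "('x, 'k) vec" and g :: "'x \<Rightarrow> 'x" and a
    assume "a \<in> words X d"
    then have "map g (map (\<lambda>j. a ! j) js) = map (\<lambda>j. map g a ! j) js"
      using assms(4) by (auto simp: words_def)
    then show "v (map_label g ((InR ^^ i) (InL (Word (map (\<lambda>j. a ! j) js))))) =
        v ((InR ^^ i) (InL (Word (map (\<lambda>j. map g a ! j) js))))"
      by (simp only: map_label_InR_power label.map)
  qed (auto simp: fscale_def)
  moreover have "?f (structure_vec Ys) =
      word_vec X d (\<lambda>a. if map (\<lambda>j. a ! j) js \<in> Ys ! i then 1 else 0)"
    if "is_structure X ms Ys" for Ys
  proof -
    \<comment> \<open>The inclusion makes the relation finite, as \<open>tensor_Word\<close>
      requires.\<close>
    have "i < length Ys" "Ys ! i \<subseteq> words X (ms ! i)"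
      using that assms(3) by (auto simp: is_structure_def list_all2_conv_all_nth)
    then show ?thesis
      using finite_subset[OF _ finite_words[OF assms(1)]]
      by (simp add: structure_vec_InL tensor_Word)
  qed
  ultimately show ?thesis
    unfolding representable_def by blast
qed

section \<open>Counting by interpolation\<close>

text \<open>A collision \<open>of_nat b = of_nat c\<close> makes the characteristic divide
  \<open>c - b \<le> n\<close>, which forces \<open>c = b\<close> in both cases of the
  hypothesis.\<close>

lemma of_nat_inj_on_atMost:
  assumes "CHAR('k::field) = 0 \<or> CHAR('k) > n"
  shows "inj_on (of_nat :: nat \<Rightarrow> 'k) {..n}"
proof -
  have "b = c" if "b \<le> c" "c \<le> n" "of_nat b = (of_nat c :: 'k)" for b c
  proof -
    have "of_nat (c - b) = (0 :: 'k)"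
      using that by (simp add: of_nat_diff)
    then have "CHAR('k) dvd c - b"
      by (simp add: of_nat_eq_0_iff_char_dvd)
    then show ?thesis
      using assms that by (auto dest: dvd_imp_le)
  qed
  then show ?thesis
    by (auto simp: inj_on_def) (metis nat_le_linear)
qed

lemma lagrange_interpolation_nat:
  fixes h :: "nat \<Rightarrow> 'k::field"
  assumes "inj_on (of_nat :: nat \<Rightarrow> 'k) {..n}" "N \<le> n"
  shows "(\<Sum>b\<le>n. h b * (\<Prod>c\<in>{..n} - {b}. (of_nat N - of_nat c) / (of_nat b - of_nat c))) = h N"
proof -
  \<comment> \<open>On the nodes the product is a Kronecker delta: for \<open>N = b\<close> every
    factor is 1, the denominators being nonzero by injectivity; otherwise the factor
    \<open>c = N\<close> vanishes.\<close>
  have "(\<Prod>c\<in>{..n} - {b}. (of_nat N - of_nat c) / (of_nat b - of_nat c :: 'k))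
      = (if N = b then 1 else 0)" if "b \<le> n" for b
  proof (cases "N = b")
    case True
    have "of_nat b - of_nat c \<noteq> (0 :: 'k)" if "c \<in> {..n} - {b}" for c
      using inj_onD[OF assms(1), of b c] that \<open>b \<le> n\<close> by auto
    then show ?thesis
      using True by (auto intro!: prod.neutral)
  next
    case False
    then show ?thesis
      using assms(2) by (auto intro!: prod_zero bexI[of _ N])
  qed
  then have "(\<Sum>b\<le>n. h b * (\<Prod>c\<in>{..n} - {b}. (of_nat N - of_nat c) / (of_nat b - of_nat c)))
      = (\<Sum>b\<le>n. if N = b then h b else 0)"
    by (intro sum.cong) auto
  then show ?thesis
    using assms(2) by simp
qed

section \<open>Counting quantifiers and connectives\<close>

context
  fixes X :: "'x set" and d :: nat and ms :: "nat list"
  assumes fin: "finite X" and d: "d \<ge> 1"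
    and ell: "ell X (structure_rep X ms :: ('x, 'k::field) rep) \<le> 2 * d"
begin

text \<open>The formula \<open>Eq 0 0\<close> always holds and yields 1; variable \<open>0\<close>
  is available because \<open>d \<ge> 1\<close>.\<close>

lemma representable_const: "representable X d ms (\<lambda>_ _. c :: 'k)"
proof -
  have "representable X d ms (\<lambda>_ _. 1 :: 'k)"
    using representable_Eq[OF fin ell, of 0 0] d by simp
  from representable_lincomb[OF this this, of c 0] show ?thesis by simp
qed

lemma representable_sum:
  fixes F :: "'i \<Rightarrow> 'x list set list \<Rightarrow> 'x list \<Rightarrow> 'k"
  assumes "\<And>i. i \<in> I \<Longrightarrow> representable X d ms (F i)"
  shows "representable X d ms (\<lambda>Ys a. \<Sum>i\<in>I. F i Ys a)"
  using assms
proof (induction I rule: infinite_finite_induct)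
  case (insert i I)
  then have "representable X d ms (\<lambda>Ys a. 1 * F i Ys a + 1 * (\<Sum>i\<in>I. F i Ys a))"
    by (intro representable_lincomb) auto
  then show ?case
    using insert by simp
qed (simp_all add: representable_const)

lemma representable_prod:
  fixes F :: "'i \<Rightarrow> 'x list set list \<Rightarrow> 'x list \<Rightarrow> 'k"
  assumes "\<And>i. i \<in> I \<Longrightarrow> representable X d ms (F i)"
  shows "representable X d ms (\<lambda>Ys a. \<Prod>i\<in>I. F i Ys a)"
  using assms
  by (induction I rule: infinite_finite_induct)
    (simp_all add: representable_const representable_mult fin)

text \<open>On the finitely many possible counts every function \<open>h\<close> is a polynomial
  over \<open>k\<close>, so all three quantifiers are instances of this closure property.\<close>

lemma representable_count:
  fixes h :: "nat \<Rightarrow> 'k"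
  assumes "inj_on (of_nat :: nat \<Rightarrow> 'k) {..card X}"
    and "representable X d ms (\<lambda>Ys a. if P Ys a then 1 else 0 :: 'k)"
  shows "representable X d ms (\<lambda>Ys a. h (card {x \<in> X. P Ys (a[j := x])}))"
proof -
  define N where "N = (\<lambda>Ys a. card {x \<in> X. P Ys (a[j := x])})"
  have "of_nat (N Ys a) = (\<Sum>x\<in>X. if P Ys (a[j := x]) then 1 else 0 :: 'k)" for Ys a
    using fin by (simp add: N_def sum.If_cases Int_def)
  then have N: "representable X d ms (\<lambda>Ys a. of_nat (N Ys a) :: 'k)"
    using representable_sum_coord[OF fin assms(2), of j] by simp
  \<comment> \<open>A linear polynomial in the count. Where \<open>b\<close> and \<open>c\<close>
    agree in \<open>k\<close>, inverse and quotient are both 0 by convention; interpolation uses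
    distinct nodes only.\<close>
  have "representable X d ms (\<lambda>Ys a. (of_nat (N Ys a) - of_nat c) / (of_nat b - of_nat c) :: 'k)"
    for b c
    using representable_lincomb[OF N representable_const[of "of_nat c"],
        of "inverse (of_nat b - of_nat c)" "- inverse (of_nat b - of_nat c)"]
    by (simp add: divide_inverse ring_distribs mult.commute)
  then have "representable X d ms (\<lambda>Ys a. \<Sum>b\<le>card X.
      h b * (\<Prod>c\<in>{..card X} - {b}. (of_nat (N Ys a) - of_nat c) / (of_nat b - of_nat c)))"
    by (intro representable_sum representable_mult representable_prod representable_const fin)
  \<comment> \<open>Hence every count is one of the interpolation nodes.\<close>
  moreover have "N Ys a \<le> card X" for Ys a
    using fin by (auto simp: N_def intro: card_mono)
  ultimately show ?thesis
    using lagrange_interpolation_nat[OF assms(1), of _ h] by (simp add: N_def)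
qed

text \<open>The complement of an indicator \<open>F\<close> is \<open>1 - F\<close>, whence the
  coefficients 1 and -1.\<close>

lemma representable_not:
  assumes "representable X d ms (\<lambda>Ys a. if P Ys a then 1 else 0 :: 'k)"
  shows "representable X d ms (\<lambda>Ys a. if \<not> P Ys a then 1 else 0 :: 'k)"
  by (rule representable_cong[OF representable_lincomb[OF representable_const[of 1] assms, of 1 "-1"]])
    simp

lemma representable_conj:
  assumes "representable X d ms (\<lambda>Ys a. if P Ys a then 1 else 0 :: 'k)"
    and "representable X d ms (\<lambda>Ys a. if Q Ys a then 1 else 0 :: 'k)"
  shows "representable X d ms (\<lambda>Ys a. if P Ys a \<and> Q Ys a then 1 else 0 :: 'k)"
  by (rule representable_cong[OF representable_mult[OF fin assms]]) simp

lemma representable_sat: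
  assumes "inj_on (of_nat :: nat \<Rightarrow> 'k) {..card X}" "in_C d ms \<phi>"
  shows "representable X d ms (\<lambda>Ys a. if sat X Ys \<phi> a then 1 else 0 :: 'k)"
  using assms(2)
proof (induction \<phi>)
  case (Eq i j)
  then show ?case using representable_Eq[OF fin ell] by simp
next
  case (Rel i js)
  then show ?case using representable_Rel[OF fin ell] by simp
next
  case (Neg \<phi>)
  then show ?case using representable_not by simp
next
  case (And \<phi> \<psi>)
  then show ?case using representable_conj by simp
next
  case (Or \<phi> \<psi>)
  \<comment> \<open>De Morgan reduces disjunction to negation and conjunction.\<close>
  then show ?case
    using representable_not[OF representable_conj[OF representable_not representable_not]] by simp
next
  case (Imp \<phi> \<psi>)
  then have "representable X d ms (\<lambda>Ys a. if \<not> (sat X Ys \<phi> a \<and> \<not> sat X Ys \<psi> a) then 1 else 0 :: 'k)"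
    by (intro representable_not representable_conj) simp_all
  then show ?case by simp
next
  case (Iff \<phi> \<psi>)
  then have "representable X d ms (\<lambda>Ys a. if \<not> (sat X Ys \<phi> a \<and> \<not> sat X Ys \<psi> a) \<and>
      \<not> (sat X Ys \<psi> a \<and> \<not> sat X Ys \<phi> a) then 1 else 0 :: 'k)"
    by (intro representable_not representable_conj) simp_all
  then show ?case by (rule representable_cong) auto
next
  case (Forall j \<phi>)
  \<comment> \<open>In a finite \<open>X\<close> a subset with \<open>card X\<close> elements is all
    of \<open>X\<close>, so the universal quantifier asks for a full count.\<close>
  have "(\<forall>x\<in>X. sat X Ys \<phi> (a[j := x])) \<longleftrightarrow> card {x \<in> X. sat X Ys \<phi> (a[j := x])} = card X" for Ys a
    using card_subset_eq[OF fin, of "{x \<in> X. sat X Ys \<phi> (a[j := x])}"]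
    by (auto intro: arg_cong[where f = card])
  then show ?case
    using representable_count[OF assms(1) Forall.IH, of "\<lambda>N. if N = card X then 1 else 0" j]
      Forall.prems by simp
next
  case (Exists j \<phi>)
  \<comment> \<open>Finiteness rules out the default value 0 of \<open>card\<close> on infinite
    sets, so a nonzero count means a witness.\<close>
  have "(\<exists>x\<in>X. sat X Ys \<phi> (a[j := x])) \<longleftrightarrow> card {x \<in> X. sat X Ys \<phi> (a[j := x])} \<noteq> 0" for Ys a
    using fin by auto
  then show ?case
    using representable_count[OF assms(1) Exists.IH, of "\<lambda>N. if N \<noteq> 0 then 1 else 0" j]
      Exists.prems by simp
next
  case (ExactlyN b j \<phi>)
  then show ?case
    using representable_count[OF assms(1) ExactlyN.IH, of "\<lambda>N. if N = b then 1 else 0" j] by simp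
qed

end

theorem theorem3p7:
  fixes X :: "'x set" and n d :: nat and ms :: "nat list" and \<phi> :: fm
  assumes "finite X" and "card X = n"
    and "CHAR('k::field) = 0 \<or> CHAR('k) > n"
    and "\<forall>m\<in>set ms. m > 0"
    and "d \<ge> 1"
    and "ell X (structure_rep X ms :: ('x, 'k) rep) \<le> 2 * d"
    and "in_C d ms \<phi>"
  shows "\<exists>f :: ('x, 'k) vec \<Rightarrow> ('x, 'k) vec.
    constructible X (2 * d) (structure_rep X ms) (tensor_power X d) f \<and>
    (\<forall>Ys. is_structure X ms Ys \<longrightarrow>
       f (structure_vec Ys) = tensor {a \<in> words X d. sat X Ys \<phi> a})"
proof -
  have "representable X d ms (\<lambda>Ys a. if sat X Ys \<phi> a then 1 else 0 :: 'k)"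
    using representable_sat[OF assms(1,5,6) _ assms(7)] of_nat_inj_on_atMost[OF assms(3)] assms(2)
    by simp
  \<comment> \<open>The sum of basis vectors over the truth set is the vector of its indicator,
    which links the claim to \<open>representable\<close>.\<close>
  moreover have "tensor {a \<in> words X d. sat X Ys \<phi> a}
      = word_vec X d (\<lambda>a. if sat X Ys \<phi> a then 1 else 0 :: 'k)" for Ys
    using assms(1) by (subst tensor_eq_word_vec) (auto intro!: word_vec_cong)
  ultimately show ?thesis
    unfolding representable_def by simp
qed

end
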